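(* Let $C$ and $p>0$ be constants and fix $\varepsilon>0$. Consider the following two optimization models. Model (P) (nonlinear mixed-integer). Decision variables: $\varphi\in\mathbb{R}$; $\mathbf{V}_j=(\triangle u_j^1,\dots,\triangle u_j^{\lambda_j})^{T}\in\mathbb{R}^{\lambda_j}$ and $\delta_j\in\{0,1\}$ for $j\in M$; $\sigma_+(a),\sigma_-(a)\in\mathbb{R}$ for $a\in A^R$. Put $u_*(a)=\sum_{j=1}^m\delta_j\,\mathbf{V}_j^{T}\mathbf{A}_j(a)$. Minimize $$C\sum_{a\in A^R}\bigl(\sigma_+(a)+\sigma_-(a)\bigr)+\Bigl(p\,\varphi+\sum_{j=1}^m\delta_j\Bigr)$$ subject to (MC) $\triangle u_j^s\ge 0$ for $s=1,\dots,\lambda_j$, $j\in M$; (NC) $\sum_{j=1}^m\delta_j\sum_{s=1}^{\lambda_j}\triangle u_j^s=1$; (SC) $|\triangle u_j^{s+1}-\triangle u_j^s|\le\varphi$ for $s=1,\dots,\lambda_j-1$, $j\in M$; (E) $u_*(a)+\sigma_+(a)-\sigma_-(a)=u_*(b)+\sigma_+(b)-\sigma_-(b)$ for every given judgment $a\sim b$; $u_*(a)+\sigma_+(a)-\sigma_-(a)\ge u_*(b)+\sigma_+(b)-\sigma_-(b)+\varepsilon$ for every given judgment $a\succ b$; and $\sigma_+(a),\sigma_-(a)\ge0$ for $a\in A^R$. Model (L) (linear mixed-integer). Decision variables: those of (P) and additionally $\mathbf{Z}_j=(z_j^1,\dots,z_j^{\lambda_j})^{T}\in\mathbb{R}^{\lambda_j}$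 for $j\in M$. Put $u_{z*}(a)=\sum_{j=1}^m\mathbf{Z}_j^{T}\mathbf{A}_j(a)$. Minimize the same objective function $$C\sum_{a\in A^R}\bigl(\sigma_+(a)+\sigma_-(a)\bigr)+\Bigl(p\,\varphi+\sum_{j=1}^m\delta_j\Bigr)$$ subject to (MC) and (SC); to (NC) replaced by $\sum_{j=1}^m\sum_{s=1}^{\lambda_j}z_j^s=1$; to (E) with $u_*$ replaced by $u_{z*}$; and to (LC) $z_j^s\le\triangle u_j^s$, $\ z_j^s\ge\triangle u_j^s-(1-\delta_j)$, $\ 0\le z_j^s\le\delta_j$ for $s=1,\dots,\lambda_j$, $j\in M$. Then models (P) and (L) are equivalent, in the following sense: for every feasible solution of either model there is a corresponding feasible solution of the other model with the same objective function value.
   Context: Let $N=\{1,\dots,n\}$, $M=\{1,\dots,m\}$; $\mathcal{A}=\{a_i: i\in N\}$ is a finite set of alternatives and $\mathcal{C}=\{c_j: j\in M\}$ a finite set of criteria. For $j\in M$, $g_j:\mathcal{A}\to[\underline{g_j},\overline{g_j}]$ (with $\underline{g_j}<\overline{g_j}$) gives the performance of alternatives on criterion $c_j$. The interval $[\underline{g_j},\overline{g_j}]$ is divided into $\lambda_j\ge1$ equal subintervals by points $\underline{g_j}=g_j^0<g_j^1<\dots<g_j^{\lambda_j}=\overline{g_j}$. For $a\in\mathcal{A}$, $\mathbf{A}_j(a)=(\alpha_j^1(a),\dots,\alpha_j^{\lambda_j}(a))^{T}$ is the constant vector with $\alpha_j^s(a)=1$ if $g_j(a)>g_j^s$, $\alpha_j^s(a)=\frac{g_j(a)-g_j^{s-1}}{g_j^s-g_j^{s-1}}$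 if $g_j^{s-1}\le g_j(a)\le g_j^s$, and $\alpha_j^s(a)=0$ if $g_j(a)<g_j^{s-1}$. A vector $\mathbf{V}_j$ represents the piecewise linear marginal value function $u_j(g_j(a))=\mathbf{V}_j^{T}\mathbf{A}_j(a)$, which satisfies $u_j(g_j^0)=0$; the entry $\triangle u_j^s$ is the value difference $u_j(g_j^s)-u_j(g_j^{s-1})$. $A^R\subseteq\mathcal{A}$ is the set of reference alternatives. The preference information is a given collection of pairwise judgments $a\succ b$ (strict preference) and $a\sim b$ (indifference) with $a,b\in A^R$. The variable $\delta_j\in\{0,1\}$ indicates whether criterion $c_j$ is selected. *)

theory Defs
  imports Complex_Main
begin

text \<open>
  Criteria are indexed by \<open>{1..num_crit D}\<close>. Vectors indexed by \<open>1, \<dots>, \<lambda>\<^sub>j\<close>, as well as quantities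
  indexed by criteria or by reference alternatives, are total functions of which only the
  entries with indices in range are ever used.
\<close>

record 'a decision_problem =
  alts :: "'a set"
  num_crit :: nat
  perf :: "nat \<Rightarrow> 'a \<Rightarrow> real"
  perf_lo :: "nat \<Rightarrow> real"
  perf_hi :: "nat \<Rightarrow> real"
  num_pieces :: "nat \<Rightarrow> nat"
  ref_alts :: "'a set"
  strict_prefs :: "('a \<times> 'a) set"
  indiffs :: "('a \<times> 'a) set"

abbreviation crits :: "'a decision_problem \<Rightarrow> nat set" where
  "crits D \<equiv> {1..num_crit D}"

abbreviation pieces :: "'a decision_problem \<Rightarrow> nat \<Rightarrow> nat set" where
  "pieces D j \<equiv> {1..num_pieces D j}"

definition decision_problem :: "'a decision_problem \<Rightarrow> bool" where
  "decision_problem D \<longleftrightarrow>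
     finite (alts D) \<and>
     (\<forall>j\<in>crits D. perf_lo D j < perf_hi D j \<and> 1 \<le> num_pieces D j \<and>
        (\<forall>a\<in>alts D. perf D j a \<in> {perf_lo D j..perf_hi D j})) \<and>
     ref_alts D \<subseteq> alts D \<and>
     strict_prefs D \<subseteq> ref_alts D \<times> ref_alts D \<and>
     indiffs D \<subseteq> ref_alts D \<times> ref_alts D"

definition breakpoint :: "'a decision_problem \<Rightarrow> nat \<Rightarrow> nat \<Rightarrow> real" where
  "breakpoint D j s =
     perf_lo D j + real s / real (num_pieces D j) * (perf_hi D j - perf_lo D j)"

text \<open>The entry \<open>\<alpha>\<^sub>j\<^sup>s(a)\<close> of \<open>\<^bold>A\<^sub>j(a)\<close>, meant for \<open>s \<ge> 1\<close>.\<close>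

definition alpha :: "'a decision_problem \<Rightarrow> nat \<Rightarrow> 'a \<Rightarrow> nat \<Rightarrow> real" where
  "alpha D j a s =
     (if perf D j a > breakpoint D j s then 1
      else if perf D j a < breakpoint D j (s - 1) then 0
      else (perf D j a - breakpoint D j (s - 1))
             / (breakpoint D j s - breakpoint D j (s - 1)))"

text \<open>
  \<open>incr x j s\<close> is \<open>\<triangle>u\<^sub>j\<^sup>s\<close> and \<open>sel x j\<close> is \<open>\<delta>\<^sub>j\<close>. The variables of model (L) extend those of
  model (P); what the two models share is stated for the common record scheme.
\<close>

record 'a vars_P =
  phi :: real
  incr :: "nat \<Rightarrow> nat \<Rightarrow> real"
  sel :: "nat \<Rightarrow> real"
  sigma_plus :: "'a \<Rightarrow> real"
  sigma_minus :: "'a \<Rightarrow> real"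

record 'a vars_L = "'a vars_P" +
  zvar :: "nat \<Rightarrow> nat \<Rightarrow> real"

definition marginal_value ::
    "'a decision_problem \<Rightarrow> (nat \<Rightarrow> nat \<Rightarrow> real) \<Rightarrow> nat \<Rightarrow> 'a \<Rightarrow> real" where
  "marginal_value D V j a = (\<Sum>s\<in>pieces D j. V j s * alpha D j a s)"

definition value_P :: "'a decision_problem \<Rightarrow> 'a vars_P \<Rightarrow> 'a \<Rightarrow> real" where
  "value_P D x a = (\<Sum>j\<in>crits D. sel x j * marginal_value D (incr x) j a)"

definition value_L :: "'a decision_problem \<Rightarrow> 'a vars_L \<Rightarrow> 'a \<Rightarrow> real" where
  "value_L D y a = (\<Sum>j\<in>crits D. marginal_value D (zvar y) j a)"

definition objective ::
    "'a decision_problem \<Rightarrow> real \<Rightarrow> real \<Rightarrow> ('a, 'b) vars_P_scheme \<Rightarrow> real" where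
  "objective D C p x =
     C * (\<Sum>a\<in>ref_alts D. sigma_plus x a + sigma_minus x a)
       + (p * phi x + (\<Sum>j\<in>crits D. sel x j))"

definition binary_selection :: "'a decision_problem \<Rightarrow> ('a, 'b) vars_P_scheme \<Rightarrow> bool" where
  "binary_selection D x \<longleftrightarrow> (\<forall>j\<in>crits D. sel x j \<in> {0, 1})"

definition MC :: "'a decision_problem \<Rightarrow> ('a, 'b) vars_P_scheme \<Rightarrow> bool" where
  "MC D x \<longleftrightarrow> (\<forall>j\<in>crits D. \<forall>s\<in>pieces D j. incr x j s \<ge> 0)"

definition SC :: "'a decision_problem \<Rightarrow> ('a, 'b) vars_P_scheme \<Rightarrow> bool" where
  "SC D x \<longleftrightarrow>
     (\<forall>j\<in>crits D. \<forall>s\<in>{1..<num_pieces D j}. \<bar>incr x j (s + 1) - incr x j s\<bar> \<le> phi x)"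

definition NC_P :: "'a decision_problem \<Rightarrow> 'a vars_P \<Rightarrow> bool" where
  "NC_P D x \<longleftrightarrow> (\<Sum>j\<in>crits D. sel x j * (\<Sum>s\<in>pieces D j. incr x j s)) = 1"

definition NC_L :: "'a decision_problem \<Rightarrow> 'a vars_L \<Rightarrow> bool" where
  "NC_L D y \<longleftrightarrow> (\<Sum>j\<in>crits D. \<Sum>s\<in>pieces D j. zvar y j s) = 1"

definition EC ::
    "'a decision_problem \<Rightarrow> real \<Rightarrow> ('a \<Rightarrow> real) \<Rightarrow> ('a, 'b) vars_P_scheme \<Rightarrow> bool" where
  "EC D \<epsilon> u x \<longleftrightarrow>
     (\<forall>(a, b)\<in>indiffs D.
        u a + sigma_plus x a - sigma_minus x a = u b + sigma_plus x b - sigma_minus x b) \<and>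
     (\<forall>(a, b)\<in>strict_prefs D.
        u a + sigma_plus x a - sigma_minus x a \<ge> u b + sigma_plus x b - sigma_minus x b + \<epsilon>) \<and>
     (\<forall>a\<in>ref_alts D. sigma_plus x a \<ge> 0 \<and> sigma_minus x a \<ge> 0)"

definition LC :: "'a decision_problem \<Rightarrow> 'a vars_L \<Rightarrow> bool" where
  "LC D y \<longleftrightarrow>
     (\<forall>j\<in>crits D. \<forall>s\<in>pieces D j.
        zvar y j s \<le> incr y j s \<and>
        zvar y j s \<ge> incr y j s - (1 - sel y j) \<and>
        0 \<le> zvar y j s \<and> zvar y j s \<le> sel y j)"

definition feasible_P :: "'a decision_problem \<Rightarrow> real \<Rightarrow> 'a vars_P \<Rightarrow> bool" where
  "feasible_P D \<epsilon> x \<longleftrightarrow>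
     binary_selection D x \<and> MC D x \<and> NC_P D x \<and> SC D x \<and> EC D \<epsilon> (value_P D x) x"

definition feasible_L :: "'a decision_problem \<Rightarrow> real \<Rightarrow> 'a vars_L \<Rightarrow> bool" where
  "feasible_L D \<epsilon> y \<longleftrightarrow>
     binary_selection D y \<and> MC D y \<and> NC_L D y \<and> SC D y \<and> EC D \<epsilon> (value_L D y) y \<and> LC D y"

end

theory Submission
  imports Defs
begin

text \<open>
  The linking constraints (LC) are the usual linearization of the product of a binary and a
  bounded variable: for \<open>\<delta>\<^sub>j \<in> {0, 1}\<close> they force \<open>z\<^sub>j\<^sup>s = \<delta>\<^sub>j \<triangle>u\<^sub>j\<^sup>s\<close>, and once this
  identity holds, normalization and preference constraints of the two models are the same. Hence
  forgetting \<open>z\<close> turns a solution of (L) into one of (P)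
  (\<open>LC_imp_zvar_eq_sel_times_incr\<close>, \<open>feasible_P_truncate\<close>).

  The converse is not just a matter of adding \<open>z\<^sub>j\<^sup>s = \<delta>\<^sub>j \<triangle>u\<^sub>j\<^sup>s\<close>, since (LC) is satisfied by
  these products only if \<open>\<triangle>u\<^sub>j\<^sup>s \<le> 1\<close>. Normalization yields this bound for the selected criteria,
  but on an unselected criterion model (P) allows arbitrarily large increments. These have no
  influence on the comprehensive values or on the objective, so they may first be reset to \<open>0\<close>
  (\<open>feasible_P_mask\<close>). Smoothness (SC) survives because every difference of consecutive increments
  of the same criterion is either kept or replaced by \<open>0\<close>. After this reset all increments are at
  most \<open>1\<close> and \<open>z = \<triangle>u\<close> is admissible.
\<close>

lemma LC_imp_zvar_eq_sel_times_incr: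
  assumes "LC D y" and "binary_selection D y" and "j \<in> crits D" and "s \<in> pieces D j"
  shows "zvar y j s = sel y j * incr y j s"
proof -
  have "sel y j \<in> {0, 1}" using assms(2,3) by (auto simp: binary_selection_def)
  moreover have "zvar y j s \<le> incr y j s" "zvar y j s \<ge> incr y j s - (1 - sel y j)"
    "0 \<le> zvar y j s" "zvar y j s \<le> sel y j"
    using assms(1,3,4) unfolding LC_def by blast+
  ultimately show ?thesis by auto
qed

lemma vars_P_truncate_sel [simp]:
  "phi (vars_P.truncate y) = phi y"
  "incr (vars_P.truncate y) = incr y"
  "sel (vars_P.truncate y) = sel y"
  "sigma_plus (vars_P.truncate y) = sigma_plus y"
  "sigma_minus (vars_P.truncate y) = sigma_minus y"
  by (simp_all add: vars_P.truncate_def)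

lemma objective_truncate: "objective D C p (vars_P.truncate y) = objective D C p y"
  by (simp add: objective_def)

lemma value_P_truncate:
  assumes "\<And>j s. j \<in> crits D \<Longrightarrow> s \<in> pieces D j \<Longrightarrow> zvar y j s = sel y j * incr y j s"
  shows "value_P D (vars_P.truncate y) = value_L D y"
  by (rule ext)
    (auto simp: value_P_def value_L_def marginal_value_def sum_distrib_left assms mult.assoc
      intro!: sum.cong)

lemma NC_P_truncate:
  assumes "\<And>j s. j \<in> crits D \<Longrightarrow> s \<in> pieces D j \<Longrightarrow> zvar y j s = sel y j * incr y j s"
  shows "NC_P D (vars_P.truncate y) \<longleftrightarrow> NC_L D y"
  by (simp add: NC_P_def NC_L_def sum_distrib_left assms)

text \<open>
  Apart from (LC), the models differ only in how they write the products \<open>\<delta>\<^sub>j \<triangle>u\<^sub>j\<^sup>s\<close>. Stated as an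
  equivalence, the lemma serves both directions of the correspondence.
\<close>

lemma feasible_P_truncate:
  assumes "\<And>j s. j \<in> crits D \<Longrightarrow> s \<in> pieces D j \<Longrightarrow> zvar y j s = sel y j * incr y j s"
  shows "feasible_P D \<epsilon> (vars_P.truncate y) \<and> LC D y \<longleftrightarrow> feasible_L D \<epsilon> y"
proof -
  have "value_P D (vars_P.truncate y) = value_L D y"
    using assms by (rule value_P_truncate)
  moreover have "NC_P D (vars_P.truncate y) \<longleftrightarrow> NC_L D y"
    using assms by (rule NC_P_truncate)
  ultimately show ?thesis
    unfolding feasible_P_def feasible_L_def
    by (auto simp: binary_selection_def MC_def SC_def EC_def)
qed

definition mask :: "'a vars_P \<Rightarrow> 'a vars_P" where
  "mask x = x\<lparr>incr := \<lambda>j s. sel x j * incr x j s\<rparr>"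

lemma mask_sel [simp]:
  "phi (mask x) = phi x"
  "incr (mask x) = (\<lambda>j s. sel x j * incr x j s)"
  "sel (mask x) = sel x"
  "sigma_plus (mask x) = sigma_plus x"
  "sigma_minus (mask x) = sigma_minus x"
  by (simp_all add: mask_def)

lemma objective_mask: "objective D C p (mask x) = objective D C p x"
  by (simp add: objective_def)

text \<open>
  Masking changes nothing in the products \<open>\<delta>\<^sub>j \<triangle>u\<^sub>j\<^sup>s\<close> because \<open>\<delta>\<^sub>j\<close> is idempotent.
\<close>

lemma sel_idem:
  assumes "binary_selection D x" and "j \<in> crits D"
  shows "sel x j * (sel x j * r) = sel x j * r"
  using assms by (auto simp: binary_selection_def)

lemma value_P_mask:
  assumes "binary_selection D x"
  shows "value_P D (mask x) = value_P D x"
  by (rule ext)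
    (auto simp: value_P_def marginal_value_def sum_distrib_left mult.assoc sel_idem[OF assms]
      intro!: sum.cong)

lemma NC_P_mask:
  assumes "binary_selection D x"
  shows "NC_P D (mask x) \<longleftrightarrow> NC_P D x"
  by (simp add: NC_P_def sum_distrib_left sel_idem[OF assms])

lemma SC_mask:
  assumes "binary_selection D x" and "SC D x"
  shows "SC D (mask x)"
  unfolding SC_def
proof (intro ballI)
  fix j s assume j: "j \<in> crits D" and s: "s \<in> {1..<num_pieces D j}"
  have "\<bar>incr x j (s + 1) - incr x j s\<bar> \<le> phi x" using assms(2) j s unfolding SC_def by blast
  moreover have "sel x j \<in> {0, 1}" using assms(1) j by (auto simp: binary_selection_def)
  \<comment> \<open>For \<open>sel x j = 0\<close> the required \<open>0 \<le> phi x\<close> comes from (SC) of \<open>x\<close> for this very pair: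
    where no such pair exists, \<open>phi x\<close> may be negative.\<close>
  ultimately show "\<bar>incr (mask x) j (s + 1) - incr (mask x) j s\<bar> \<le> phi (mask x)" by auto
qed

lemma feasible_P_mask:
  assumes "feasible_P D \<epsilon> x"
  shows "feasible_P D \<epsilon> (mask x)"
proof -
  have bin: "binary_selection D x" using assms by (simp add: feasible_P_def)
  have "MC D (mask x)"
    using assms by (fastforce simp: feasible_P_def MC_def binary_selection_def)
  moreover have "binary_selection D (mask x)" using bin by (simp add: binary_selection_def)
  ultimately show ?thesis
    using assms SC_mask[OF bin]
    by (simp add: feasible_P_def value_P_mask[OF bin] NC_P_mask[OF bin] EC_def)
qed

text \<open>
  The nonnegative products \<open>\<delta>\<^sub>j \<triangle>u\<^sub>j\<^sup>s\<close> add up to \<open>1\<close> by normalization, so none exceeds \<open>1\<close>.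
\<close>

lemma selected_incr_le_1:
  assumes "feasible_P D \<epsilon> x" and j: "j \<in> crits D" and s: "s \<in> pieces D j"
  shows "sel x j * incr x j s \<le> 1"
proof -
  let ?f = "\<lambda>j s. sel x j * incr x j s"
  have nonneg: "0 \<le> ?f i t" if "i \<in> crits D" "t \<in> pieces D i" for i t
  proof -
    have "sel x i \<in> {0, 1}" "0 \<le> incr x i t"
      using assms(1) that unfolding feasible_P_def binary_selection_def MC_def by blast+
    then show ?thesis by auto
  qed
  have "?f j s \<le> (\<Sum>t\<in>pieces D j. ?f j t)"
    by (rule member_le_sum) (use s nonneg[OF j] in auto)
  also have "\<dots> \<le> (\<Sum>i\<in>crits D. \<Sum>t\<in>pieces D i. ?f i t)"
    by (rule member_le_sum[where f = "\<lambda>i. \<Sum>t\<in>pieces D i. ?f i t"])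
      (use j nonneg in \<open>auto intro!: sum_nonneg\<close>)
  also have "\<dots> = 1"
    using assms(1) by (simp add: feasible_P_def NC_P_def sum_distrib_left)
  finally show ?thesis .
qed

definition linearize :: "'a vars_P \<Rightarrow> 'a vars_L" where
  "linearize x = vars_P.extend (mask x) (vars_L.fields (incr (mask x)))"

lemma truncate_linearize: "vars_P.truncate (linearize x) = mask x"
  by (simp add: linearize_def vars_P.truncate_def vars_P.extend_def)

lemma linearize_sel [simp]:
  "incr (linearize x) = (\<lambda>j s. sel x j * incr x j s)"
  "sel (linearize x) = sel x"
  "zvar (linearize x) = (\<lambda>j s. sel x j * incr x j s)"
  by (simp_all add: linearize_def vars_P.extend_def vars_L.fields_def)

lemma LC_linearize:
  assumes "feasible_P D \<epsilon> x"
  shows "LC D (linearize x)"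
  unfolding LC_def
proof (intro ballI)
  fix j s assume j: "j \<in> crits D" and s: "s \<in> pieces D j"
  have "sel x j \<in> {0, 1}" "0 \<le> incr x j s"
    using assms j s unfolding feasible_P_def binary_selection_def MC_def by blast+
  moreover have "sel x j * incr x j s \<le> 1" by (rule selected_incr_le_1[OF assms j s])
  ultimately show "zvar (linearize x) j s \<le> incr (linearize x) j s \<and>
      zvar (linearize x) j s \<ge> incr (linearize x) j s - (1 - sel (linearize x) j) \<and>
      0 \<le> zvar (linearize x) j s \<and> zvar (linearize x) j s \<le> sel (linearize x) j"
    by auto
qed

lemma feasible_L_linearize:
  assumes "feasible_P D \<epsilon> x"
  shows "feasible_L D \<epsilon> (linearize x)"
proof -
  have "binary_selection D x" using assms by (simp add: feasible_P_def)
  then have "feasible_P D \<epsilon> (vars_P.truncate (linearize x)) \<and> LC D (linearize x)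
      \<longleftrightarrow> feasible_L D \<epsilon> (linearize x)"
    by (intro feasible_P_truncate) (simp add: sel_idem)
  then show ?thesis
    using feasible_P_mask[OF assms] LC_linearize[OF assms] by (simp add: truncate_linearize)
qed

lemma objective_linearize: "objective D C p (linearize x) = objective D C p x"
  by (metis objective_mask objective_truncate truncate_linearize)

theorem proposition5p1:
  fixes D :: "'a decision_problem" and C p \<epsilon> :: real
  assumes "decision_problem D" and "p > 0" and "\<epsilon> > 0"
  shows "(\<forall>x :: 'a vars_P. feasible_P D \<epsilon> x \<longrightarrow>
            (\<exists>y :: 'a vars_L. feasible_L D \<epsilon> y \<and> objective D C p y = objective D C p x)) \<and>
         (\<forall>y :: 'a vars_L. feasible_L D \<epsilon> y \<longrightarrow>
            (\<exists>x :: 'a vars_P. feasible_P D \<epsilon> x \<and> objective D C p x = objective D C p y))"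
proof (intro conjI allI impI)
  fix x :: "'a vars_P" assume "feasible_P D \<epsilon> x"
  then show "\<exists>y :: 'a vars_L. feasible_L D \<epsilon> y \<and> objective D C p y = objective D C p x"
    using feasible_L_linearize objective_linearize by blast
next
  fix y :: "'a vars_L" assume y: "feasible_L D \<epsilon> y"
  then have "LC D y" "binary_selection D y" by (simp_all add: feasible_L_def)
  then have "feasible_P D \<epsilon> (vars_P.truncate y) \<and> LC D y \<longleftrightarrow> feasible_L D \<epsilon> y"
    by (intro feasible_P_truncate LC_imp_zvar_eq_sel_times_incr)
  with y have "feasible_P D \<epsilon> (vars_P.truncate y)" by blast
  then show "\<exists>x :: 'a vars_P. feasible_P D \<epsilon> x \<and> objective D C p x = objective D C p y"
    using objective_truncate by blast
qed

end
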